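(* Let $1\le p<\infty$ and let $\hat{e}=(e_n,e_n^\star)$ be the standard Schauder basis of $\ell_p$. The following are equivalent for any nontrivial ideal $\mathcal{I}$ on $\omega$: (a) there is $\hat{a}\subseteq\ell_p\times\ell_p^\star$ simple over $\hat{e}$ such that $\mathcal{CR}(\ell_p,\hat{a})=\mathcal{I}$; (b) $\mathcal{I}=\mathcal{I}^{t}_{r}$ for some strictly increasing $t=(t_k)\in\omega^\omega$ with $t_0=0$ and some sequence $r=(r_n)$ of positive reals such that $\sum_{n\in\omega}r_n=\infty$.
   Context: $\omega=\{0,1,2,\dots\}$. An ideal on $\omega$ is a family $\mathcal{I}\subseteq\mathcal{P}(\omega)$ containing all finite sets and closed under subsets and finite unions; it is nontrivial if $\mathcal{I}\ne\mathcal{P}(\omega)$. For $r=(r_n)$ positive reals with $\sum_n r_n=\infty$ put $\mathcal{I}_r=\{A\subseteq\omega:\sum_{n\in A}r_n<\infty\}$. For increasing $t\in\omega^\omega$ with $t_0=0$ put $\mathcal{I}_r^t=\{A\subseteq\omega:\{k\in\omega:A\cap[t_k,t_{k+1})\ne\emptyset\}\in\mathcal{I}_r\}$. Let $X$ be a Banach space with scalar field $\mathbb{K}$ and continuous dual $X^\star$. All sequences of pairs $\hat{a}=(a_n,a_n^\star)_{n\in\omega}$ with $a_n\in X$, $a_n^\star:X\to\mathbb{K}$ are assumed biorthogonal: $a_n^\star(a_m)=\delta_{nm}$. Put $S_n(\hat{a})(x)=\sum_{i=0}^n a_i^\star(x)a_i$. For an ideal $\mathcal{I}$ on $\omega$,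 $\hat{a}$ is an $\mathcal{I}$-Schauder basis of $X$ if $\{n\in\omega:\|x-S_n(\hat{a})(x)\|_X\ge\varepsilon\}\in\mathcal{I}$ for all $x\in X$, $\varepsilon>0$. The critical ideal $\mathcal{CR}(X,\hat{a})$ is the (unique, possibly trivial) ideal on $\omega$ such that for every ideal $\mathcal{I}$ on $\omega$: $\hat{a}$ is an $\mathcal{I}$-Schauder basis of $X$ iff $\mathcal{CR}(X,\hat{a})\subseteq\mathcal{I}$. $\hat{a}\subseteq X\times X^\star$ is simple over $\hat{u}\subseteq X\times X^\star$ if there are $D\subseteq\omega$, a function $h:D\to\omega$ that is interval-to-one (each $h^{-1}[\{k\}]$ is empty or an interval of $\omega$ contained in $D$), and vectors $(b_k)_{k\in h[D]}\subseteq X\setminus\{0\}$ such that for all $x\in X$: $S_n(\hat{u})(x)-S_n(\hat{a})(x)=0$ if $n\in\omega\setminus D$, and $=u_{h(n)}^\star(x)\,b_{h(n)}$ if $n\in D$. *)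

theory Defs
  imports "HOL-Analysis.Analysis" "HOL-Library.Function_Algebras"
begin

text \<open>
  The space \<open>l_p\<close> depends on the real number \<open>p\<close>, so it cannot be a type. A normed space is
  therefore given by explicit data on an ambient abelian group \<open>'v\<close>: a carrier, a scalar
  multiplication by \<open>'k\<close> and a norm (of which only the values on the carrier matter).

  The scalar field is a type \<open>'k\<close>, which in the theorem has the sort
  \<open>{real_normed_field, banach}\<close>. By Mazur's theorem the complete real normed fields
  (with multiplicative norm) are, up to isometric isomorphism, exactly the reals and
  the complex numbers.
\<close>

definition ideal_on_nat :: "nat set set \<Rightarrow> bool" where
  "ideal_on_nat I \<longleftrightarrow>
     (\<forall>A. finite A \<longrightarrow> A \<in> I) \<and>
     (\<forall>A B. A \<in> I \<longrightarrow> B \<subseteq> A \<longrightarrow> B \<in> I) \<and>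
     (\<forall>A B. A \<in> I \<longrightarrow> B \<in> I \<longrightarrow> A \<union> B \<in> I)"

definition summable_ideal :: "(nat \<Rightarrow> real) \<Rightarrow> nat set set" where
  "summable_ideal r = {A. r summable_on A}"

definition block_summable_ideal :: "(nat \<Rightarrow> nat) \<Rightarrow> (nat \<Rightarrow> real) \<Rightarrow> nat set set" where
  "block_summable_ideal t r = {A. {k. A \<inter> {t k..<t (Suc k)} \<noteq> {}} \<in> summable_ideal r}"

record ('k, 'v) nspace =
  vcarrier :: "'v set"
  vscale :: "'k \<Rightarrow> 'v \<Rightarrow> 'v"
  vnorm :: "'v \<Rightarrow> real"

abbreviation vdist :: "('k, 'v::ab_group_add) nspace \<Rightarrow> 'v \<Rightarrow> 'v \<Rightarrow> real" where
  "vdist X x y \<equiv> vnorm X (x - y)"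

text \<open>Two functions that agree on the carrier are the same functional; values elsewhere are
  unconstrained.\<close>

definition vdual :: "('k::real_normed_field, 'v::ab_group_add) nspace \<Rightarrow> ('v \<Rightarrow> 'k) set" where
  "vdual X = {f.
     (\<forall>x\<in>vcarrier X. \<forall>y\<in>vcarrier X. f (x + y) = f x + f y) \<and>
     (\<forall>c. \<forall>x\<in>vcarrier X. f (vscale X c x) = c * f x) \<and>
     continuous_map (Metric_space.mtopology (vcarrier X) (vdist X)) euclidean f}"

definition biorthogonal :: "(nat \<Rightarrow> 'v \<times> ('v \<Rightarrow> 'k::real_normed_field)) \<Rightarrow> bool" where
  "biorthogonal a \<longleftrightarrow> (\<forall>n m. snd (a n) (fst (a m)) = (if n = m then 1 else 0))"

definition partial_sum ::
    "('k, 'v::ab_group_add) nspace \<Rightarrow> (nat \<Rightarrow> 'v \<times> ('v \<Rightarrow> 'k)) \<Rightarrow> nat \<Rightarrow> 'v \<Rightarrow> 'v" where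
  "partial_sum X a n x = (\<Sum>i=0..n. vscale X (snd (a i) x) (fst (a i)))"

definition ideal_schauder_basis ::
    "('k, 'v::ab_group_add) nspace \<Rightarrow> nat set set \<Rightarrow> (nat \<Rightarrow> 'v \<times> ('v \<Rightarrow> 'k)) \<Rightarrow> bool" where
  "ideal_schauder_basis X I a \<longleftrightarrow>
     (\<forall>x\<in>vcarrier X. \<forall>\<epsilon>>0. {n. vnorm X (x - partial_sum X a n x) \<ge> \<epsilon>} \<in> I)"

definition critical_ideal ::
    "('k, 'v::ab_group_add) nspace \<Rightarrow> (nat \<Rightarrow> 'v \<times> ('v \<Rightarrow> 'k)) \<Rightarrow> nat set set" where
  "critical_ideal X a = (THE J. ideal_on_nat J \<and>
     (\<forall>I. ideal_on_nat I \<longrightarrow> (ideal_schauder_basis X I a \<longleftrightarrow> J \<subseteq> I)))"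

lemma ex1_critical_ideal:
  "\<exists>!J. ideal_on_nat J \<and> (\<forall>I. ideal_on_nat I \<longrightarrow> (ideal_schauder_basis X I a \<longleftrightarrow> J \<subseteq> I))"
proof (rule ex_ex1I)
  define J where "J = \<Inter>{I. ideal_on_nat I \<and> ideal_schauder_basis X I a}"
  have 1: "ideal_on_nat J"
    unfolding ideal_on_nat_def
  proof (intro conjI allI impI)
    fix A :: "nat set" assume "finite A"
    then show "A \<in> J" by (simp add: J_def ideal_on_nat_def)
  next
    fix A B :: "nat set" assume "A \<in> J" "B \<subseteq> A"
    then show "B \<in> J" unfolding J_def by (simp add: ideal_on_nat_def) metis
  next
    fix A B :: "nat set" assume "A \<in> J" "B \<in> J"
    then show "A \<union> B \<in> J" by (simp add: J_def ideal_on_nat_def)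
  qed
  have 2: "ideal_schauder_basis X J a"
    by (simp add: J_def ideal_schauder_basis_def)
  have 3: "ideal_schauder_basis X I a \<longleftrightarrow> J \<subseteq> I" if "ideal_on_nat I" for I
  proof
    assume "ideal_schauder_basis X I a"
    then show "J \<subseteq> I" using that by (auto simp: J_def)
  next
    assume "J \<subseteq> I"
    then show "ideal_schauder_basis X I a"
      using 2 by (auto simp: ideal_schauder_basis_def subset_iff)
  qed
  show "\<exists>J. ideal_on_nat J \<and> (\<forall>I. ideal_on_nat I \<longrightarrow> (ideal_schauder_basis X I a \<longleftrightarrow> J \<subseteq> I))"
    using 1 3 by blast
qed (meson order_refl subset_antisym)

text \<open>A subset of \<open>nat\<close> is empty or an interval iff it is order-convex; infinite intervals
  \<open>{m..}\<close> are admitted.\<close>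

definition interval_to_one_on :: "nat set \<Rightarrow> (nat \<Rightarrow> nat) \<Rightarrow> bool" where
  "interval_to_one_on D h \<longleftrightarrow> (\<forall>k. \<forall>i\<in>D \<inter> h -` {k}. \<forall>j\<in>D \<inter> h -` {k}. {i..j} \<subseteq> D \<inter> h -` {k})"

definition simple_over ::
    "('k, 'v::ab_group_add) nspace \<Rightarrow> (nat \<Rightarrow> 'v \<times> ('v \<Rightarrow> 'k)) \<Rightarrow> (nat \<Rightarrow> 'v \<times> ('v \<Rightarrow> 'k)) \<Rightarrow> bool" where
  "simple_over X a u \<longleftrightarrow> (\<exists>D h b.
     interval_to_one_on D h \<and>
     (\<forall>k\<in>h ` D. b k \<in> vcarrier X - {0}) \<and>
     (\<forall>x\<in>vcarrier X. \<forall>n.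
        partial_sum X u n x - partial_sum X a n x =
          (if n \<in> D then vscale X (snd (u (h n)) x) (b (h n)) else 0)))"

definition ell :: "real \<Rightarrow> ('k::real_normed_field, nat \<Rightarrow> 'k) nspace" where
  "ell p = \<lparr>vcarrier = {x. summable (\<lambda>n. norm (x n) powr p)},
            vscale = (\<lambda>c x n. c * x n),
            vnorm = (\<lambda>x. (\<Sum>n. norm (x n) powr p) powr (1 / p))\<rparr>"

definition standard_basis :: "nat \<Rightarrow> (nat \<Rightarrow> 'k) \<times> ((nat \<Rightarrow> 'k) \<Rightarrow> 'k::real_normed_field)" where
  "standard_basis n = ((\<lambda>k. if k = n then 1 else 0), (\<lambda>x. x n))"

lemma biorthogonal_standard_basis: "biorthogonal standard_basis"
  by (auto simp: biorthogonal_def standard_basis_def)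

lemma powr_convex_ge0:
  fixes a b l p :: real
  assumes "1 \<le> p" "0 \<le> a" "0 \<le> b" "0 \<le> l" "l \<le> 1"
  shows "(l * a + (1 - l) * b) powr p \<le> l * a powr p + (1 - l) * b powr p"
proof -
  have shrink: "(m * c) powr p \<le> m * c powr p" if "0 \<le> m" "m \<le> 1" "0 \<le> c" for m c :: real
  proof (cases "m = 0")
    case False
    have "m powr p \<le> m powr 1"
      using that assms(1) False by (intro powr_mono') auto
    then show ?thesis
      using that False by (simp add: powr_mult mult_right_mono)
  qed simp
  show ?thesis
  proof (cases "a = 0 \<or> b = 0")
    case True
    then show ?thesis using shrink[of l a] shrink[of "1 - l" b] assms by auto
  next
    case False
    then have "0 < a" "0 < b" using assms by auto
    then show ?thesis
      using convex_onD[OF powr_convex[OF assms(1)], of "1 - l" a b] assms by simp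
  qed
qed

lemma ell_scale_closed:
  assumes "x \<in> vcarrier (ell p)"
  shows "vscale (ell p) c x \<in> vcarrier (ell p)"
  using assms by (auto simp: ell_def norm_mult powr_mult intro: summable_mult)

lemma ell_norm_powr:
  assumes "1 \<le> p" "x \<in> vcarrier (ell p)"
  shows "vnorm (ell p) x powr p = (\<Sum>n. norm (x n) powr p)"
  using assms by (auto simp: ell_def powr_powr suminf_nonneg)

lemma ell_coord_le:
  assumes "1 \<le> p" "x \<in> vcarrier (ell p)"
  shows "norm (x n) \<le> vnorm (ell p) x"
proof -
  have s: "summable (\<lambda>n. norm (x n) powr p)" using assms by (simp add: ell_def)
  have "norm (x n) powr p \<le> (\<Sum>n. norm (x n) powr p)"
    using sum_le_suminf[OF s, of "{n}"] by simp
  then have "(norm (x n) powr p) powr (1 / p) \<le> vnorm (ell p) x"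
    using assms by (auto simp: ell_def intro!: powr_mono2)
  then show ?thesis using assms by (simp add: powr_powr)
qed

lemma ell_add:
  assumes p: "1 \<le> p" and x: "x \<in> vcarrier (ell p)" and y: "y \<in> vcarrier (ell p)"
  shows "x + y \<in> vcarrier (ell p)" and "vnorm (ell p) (x + y) \<le> vnorm (ell p) x + vnorm (ell p) y"
proof -
  have sx: "summable (\<lambda>n. norm (x n) powr p)" and sy: "summable (\<lambda>n. norm (y n) powr p)"
    using x y by (auto simp: ell_def)
  have nn: "0 \<le> vnorm (ell p) z" for z :: "nat \<Rightarrow> 'a" by (simp add: ell_def)
  have gen: "x + y \<in> vcarrier (ell p) \<and> vnorm (ell p) (x + y) \<le> A + B"
    if A: "vnorm (ell p) x \<le> A" "0 < A" and B: "vnorm (ell p) y \<le> B" "0 < B" for A B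
  proof -
    define l where "l = A / (A + B)"
    define g where "g n = (A + B) powr p * (l * (norm (x n) powr p / A powr p)
        + (1 - l) * (norm (y n) powr p / B powr p))" for n
    have l: "0 \<le> l" "l \<le> 1" using that by (auto simp: l_def)
    have l': "1 - l = B / (A + B)" using that by (simp add: l_def field_simps)
    have le: "norm ((x + y) n) powr p \<le> g n" for n
    proof -
      have e: "(A + B) * (l * (norm (x n) / A) + (1 - l) * (norm (y n) / B)) = norm (x n) + norm (y n)"
      proof -
        have "(A + B) * l = A" "(A + B) * (1 - l) = B"
          using that by (simp_all only: l', simp_all add: l_def)
        then show ?thesis
          using that unfolding distrib_left mult.assoc[symmetric] by simp
      qed
      have "norm ((x + y) n) powr p \<le> (norm (x n) + norm (y n)) powr p"
        using p by (intro powr_mono2) (auto intro: norm_triangle_ineq)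
      also have "\<dots> = (A + B) powr p * (l * (norm (x n) / A) + (1 - l) * (norm (y n) / B)) powr p"
        unfolding e[symmetric] using that l by (subst powr_mult) auto
      also have "\<dots> \<le> g n"
        unfolding g_def
        using powr_convex_ge0[of p "norm (x n) / A" "norm (y n) / B" l] p l that
        by (intro mult_left_mono) (auto simp: powr_divide)
      finally show ?thesis .
    qed
    have sg: "g sums ((A + B) powr p * (l * ((\<Sum>n. norm (x n) powr p) / A powr p)
        + (1 - l) * ((\<Sum>n. norm (y n) powr p) / B powr p)))"
      unfolding g_def
      by (intro sums_mult sums_add sums_divide summable_sums sx sy)
    have s: "summable (\<lambda>n. norm ((x + y) n) powr p)"
      by (rule summable_comparison_test'[OF sums_summable[OF sg], of 0]) (use le in simp)
    have q: "(\<Sum>n. norm (x n) powr p) / A powr p \<le> 1" "(\<Sum>n. norm (y n) powr p) / B powr p \<le> 1"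
      unfolding ell_norm_powr[OF p x, symmetric] ell_norm_powr[OF p y, symmetric]
      using that p powr_mono2[of p "vnorm (ell p) x" A] powr_mono2[of p "vnorm (ell p) y" B] nn
      by auto
    have "(\<Sum>n. norm ((x + y) n) powr p) \<le> suminf g"
      using le s sums_summable[OF sg] by (intro suminf_le) auto
    also have "\<dots> \<le> (A + B) powr p * (l * 1 + (1 - l) * 1)"
      unfolding sums_unique[OF sg, symmetric]
      using q l by (intro mult_left_mono add_mono) auto
    finally have "(\<Sum>n. norm ((x + y) n) powr p) powr (1 / p) \<le> ((A + B) powr p) powr (1 / p)"
      using p s by (intro powr_mono2) (auto intro: suminf_nonneg)
    then show ?thesis using p s that by (auto simp: ell_def powr_powr)
  qed
  show "x + y \<in> vcarrier (ell p)"
    using gen[of "vnorm (ell p) x + 1" "vnorm (ell p) y + 1"] nn[of x] nn[of y] by simp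
  show "vnorm (ell p) (x + y) \<le> vnorm (ell p) x + vnorm (ell p) y"
  proof (rule field_le_epsilon)
    fix e :: real assume "0 < e"
    then show "vnorm (ell p) (x + y) \<le> vnorm (ell p) x + vnorm (ell p) y + e"
      using gen[of "vnorm (ell p) x + e / 2" "vnorm (ell p) y + e / 2"] nn[of x] nn[of y] by auto
  qed
qed

lemma ell_minus_commute: "vnorm (ell p) (x - y) = vnorm (ell p) (y - x)"
  by (simp add: ell_def norm_minus_commute)

lemma ell_diff_closed:
  assumes "1 \<le> p" "x \<in> vcarrier (ell p)" "y \<in> vcarrier (ell p)"
  shows "x - y \<in> vcarrier (ell p)"
proof -
  have "- y \<in> vcarrier (ell p)" using assms by (simp add: ell_def)
  then show ?thesis using ell_add(1)[of p x "- y"] assms by simp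
qed

lemma Metric_space_ell:
  assumes p: "1 \<le> p"
  shows "Metric_space (vcarrier (ell p)) (vdist (ell p :: ('k::real_normed_field, _) nspace))"
proof
  fix x y z :: "nat \<Rightarrow> 'k"
  show "0 \<le> vdist (ell p) x y" by (simp add: ell_def)
  show "vdist (ell p) x y = vdist (ell p) y x" by (rule ell_minus_commute)
  assume x: "x \<in> vcarrier (ell p)" and y: "y \<in> vcarrier (ell p)"
  show "vdist (ell p) x y = 0 \<longleftrightarrow> x = y"
  proof
    assume "vdist (ell p) x y = 0"
    then have "x n = y n" for n
      using ell_coord_le[OF p ell_diff_closed[OF p x y], of n] by simp
    then show "x = y" by blast
  qed (simp add: ell_def)
  assume z: "z \<in> vcarrier (ell p)"
  show "vdist (ell p) x z \<le> vdist (ell p) x y + vdist (ell p) y z"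
    using ell_add(2)[OF p ell_diff_closed[OF p x y] ell_diff_closed[OF p y z]] by simp
qed

lemma standard_basis_in_ell:
  assumes p: "1 \<le> p"
  shows "range standard_basis \<subseteq>
    vcarrier (ell p) \<times> vdual (ell p :: ('k::real_normed_field, _) nspace)"
proof -
  interpret M: Metric_space "vcarrier (ell p)" "vdist (ell p :: ('k, _) nspace)"
    by (rule Metric_space_ell[OF p])
  have 1: "fst (standard_basis n) \<in> vcarrier (ell p :: ('k, _) nspace)" for n
    by (auto simp: ell_def standard_basis_def split: if_splits intro!: summable_finite[of "{n}"])
  have "continuous_map M.mtopology euclidean (\<lambda>x. x n)" for n
  proof -
    have "dist (x n) (y n) \<le> vdist (ell p) x y"
      if "x \<in> vcarrier (ell p)" "y \<in> vcarrier (ell p)" for x y :: "nat \<Rightarrow> 'k"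
      using ell_coord_le[OF p ell_diff_closed[OF p that], of n] by (simp add: dist_norm)
    then show ?thesis
      unfolding mtopology_is_euclidean[symmetric]
        M.metric_continuous_map[OF Met_TC.Metric_space_axioms]
      by (meson UNIV_I image_subsetI le_less_trans)
  qed
  then have 2: "snd (standard_basis n) \<in> vdual (ell p :: ('k, _) nspace)" for n
    by (auto simp: vdual_def standard_basis_def ell_def)
  show ?thesis using 1 2 by (metis image_subsetI mem_Times_iff)
qed

end

theory Submission
  imports Defs
begin

text \<open>
  Let \<open>a\<close> be simple over the standard basis, with data \<open>D\<close>, \<open>h\<close>, \<open>b\<close>. Since the standard
  partial sums converge, the error of the partial sums of \<open>a\<close> at \<open>x\<close> is, up to a null sequence,
  \<open>norm (x (h n)) * vnorm (b (h n))\<close> on \<open>D\<close> and \<open>0\<close> off \<open>D\<close>. As \<open>x\<close> ranges over \<open>l_p\<close>, the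
  critical ideal consists of the \<open>A\<close> with \<open>A - D\<close> finite and
  \<open>vnorm (b k) powr (- p)\<close> summable over \<open>h ` (A \<inter> D)\<close>. If it is proper, the fibres of \<open>h\<close> are
  finite intervals; together with the singletons off \<open>D\<close>, given weight 1, they are the blocks.

  Conversely, given \<open>t\<close> and \<open>r\<close>, put a positive sequence \<open>v\<close> on the block starts and take a
  summing basis there: at \<open>n = t k\<close> the vector \<open>\<Sum>j\<le>k. v j e_{t j}\<close> with the functional
  \<open>x (t k) / v k - x (t (k + 1)) / v (k + 1)\<close>, and the standard pair elsewhere. On the block \<open>k\<close>
  the partial sums miss the standard ones by
  \<open>x (t (k + 1)) / v (k + 1)\<close> times that vector, so the weight of the block is
  \<open>v (k + 1) powr p / (\<Sum>j\<le>k. v j powr p)\<close>; \<open>v\<close> can be chosen recursively to make it \<open>r k\<close>.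
\<close>

section \<open>The critical ideal of a simple system\<close>

lemma critical_ideal_eqI:
  assumes "ideal_on_nat J"
    and "\<And>I. ideal_on_nat I \<Longrightarrow> ideal_schauder_basis X I a \<longleftrightarrow> J \<subseteq> I"
  shows "critical_ideal X a = J"
  unfolding critical_ideal_def using assms by (intro the1_equality[OF ex1_critical_ideal]) auto

section \<open>Norms, standard partial sums and tails in \<open>ell p\<close>\<close>

lemma vnorm_ell_scale:
  assumes "1 \<le> p" "x \<in> vcarrier (ell p)"
  shows "vnorm (ell p) (vscale (ell p) c x) = norm c * vnorm (ell p) x"
proof -
  have s: "summable (\<lambda>n. norm (x n) powr p)" using assms(2) by (simp add: ell_def)
  have "(\<Sum>n. norm (c * x n) powr p) = norm c powr p * (\<Sum>n. norm (x n) powr p)"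
    unfolding norm_mult powr_mult using s by (rule suminf_mult)
  then show ?thesis
    using assms(1) s by (simp add: ell_def powr_mult suminf_nonneg powr_powr)
qed

lemma vnorm_ell: "vnorm (ell p) x = (\<Sum>n. norm (x n) powr p) powr (1 / p)"
  by (simp add: ell_def)

lemma vnorm_ell_zero: "vnorm (ell p) 0 = 0"
  by (simp add: ell_def)

lemma vnorm_ell_pos:
  assumes "1 \<le> p" "x \<in> vcarrier (ell p) - {0}"
  shows "0 < vnorm (ell p) x"
proof -
  obtain n where "x n \<noteq> 0" using assms(2) by (auto simp: fun_eq_iff)
  then show ?thesis using ell_coord_le[OF assms(1), of x n] assms(2)
    by (smt (verit) DiffD1 zero_less_norm_iff)
qed

lemma partial_sum_0: "partial_sum (ell p) a 0 x = (\<lambda>k. snd (a 0) x * fst (a 0) k)"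
  by (simp add: partial_sum_def ell_def)

lemma partial_sum_Suc:
  "partial_sum (ell p) a (Suc n) x k
    = partial_sum (ell p) a n x k + snd (a (Suc n)) x * fst (a (Suc n)) k"
  by (simp add: partial_sum_def ell_def)

lemma partial_sum_standard_basis:
  "partial_sum (ell p) standard_basis n x = (\<lambda>k. if k \<le> n then x k else 0)"
proof (induction n)
  case 0
  show ?case by (auto simp: partial_sum_0 standard_basis_def)
next
  case (Suc n)
  then show ?case by (auto simp: fun_eq_iff partial_sum_Suc standard_basis_def le_Suc_eq)
qed

lemma finitely_supported_in_ell:
  assumes "finite {k. x k \<noteq> 0}"
  shows "x \<in> vcarrier (ell p)"
  using assms by (auto simp: ell_def intro!: summable_finite[OF assms])

lemma partial_sum_standard_basis_in_ell:
  "partial_sum (ell p) standard_basis n x \<in> vcarrier (ell p)"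
  unfolding partial_sum_standard_basis
  by (rule finitely_supported_in_ell) (auto intro: finite_subset[of _ "{..n}"])

text \<open>The p-th power of this norm is the tail beyond \<open>n\<close> of a convergent
  series.\<close>

lemma eventually_tail_less:
  assumes p: "1 \<le> p" and x: "x \<in> vcarrier (ell p)" and e: "0 < e"
  obtains N where
    "\<And>n. N \<le> n \<Longrightarrow> vnorm (ell p) (x - partial_sum (ell p) standard_basis n x) < e"
proof -
  define f where "f k = norm (x k) powr p" for k
  have f: "summable f" using x by (simp add: ell_def f_def[abs_def])
  have pos: "0 < e powr p" using e by simp
  obtain N where N: "\<forall>n\<ge>N. norm (\<Sum>i. f (i + n)) < e powr p"
    using suminf_exist_split[OF pos f] ..
  show ?thesis
  proof (rule that[of N])
    fix n assume n: "N \<le> n"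
    define g where "g k = (if k \<le> n then 0 else f k)" for k
    have g: "summable g"
      by (rule summable_comparison_test'[OF f, of 0]) (simp add: g_def f_def)
    have eq: "(\<Sum>k. norm ((x - partial_sum (ell p) standard_basis n x) k) powr p) = suminf g"
      unfolding partial_sum_standard_basis by (intro suminf_cong) (simp add: g_def f_def)
    have "suminf g = (\<Sum>i. f (i + Suc n))"
      using suminf_split_initial_segment[OF g, of "Suc n"] by (simp add: g_def)
    moreover have "norm (\<Sum>i. f (i + Suc n)) < e powr p" using N n le_SucI by blast
    ultimately have less: "suminf g < e powr p" by (simp only: real_norm_def abs_less_iff)
    have "0 \<le> suminf g" by (rule suminf_nonneg[OF g]) (simp add: g_def f_def)
    then have "suminf g powr (1 / p) < (e powr p) powr (1 / p)"
      using p less by (intro powr_less_mono2) auto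
    then have "vnorm (ell p) (x - partial_sum (ell p) standard_basis n x)
        < (e powr p) powr (1 / p)"
      by (simp only: vnorm_ell eq)
    also have "(e powr p) powr (1 / p) = e" using p e by (simp add: powr_powr)
    finally show "vnorm (ell p) (x - partial_sum (ell p) standard_basis n x) < e" .
  qed
qed

text \<open>Lets finiteness off \<open>D\<close> be expressed by summability with weight 1.\<close>

lemma summable_on_const_one_iff: "(\<lambda>_. 1 :: real) summable_on A \<longleftrightarrow> finite A"
proof
  assume "(\<lambda>_. 1 :: real) summable_on A"
  then show "finite A"
    using infsum_diverge_constant[of A "1 :: real"] by auto
qed simp

lemma summable_on_Un_iff:
  fixes f :: "'a \<Rightarrow> real"
  shows "f summable_on (A \<union> B) \<longleftrightarrow> f summable_on A \<and> f summable_on B"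
  by (meson Un_upper1 Un_upper2 summable_on_subset_banach summable_on_union)

section \<open>Error estimates and the critical ideal\<close>

locale simple_system =
  fixes p :: real and a :: "nat \<Rightarrow> (nat \<Rightarrow> 'k::real_normed_field) \<times> ((nat \<Rightarrow> 'k) \<Rightarrow> 'k)"
    and D :: "nat set" and h :: "nat \<Rightarrow> nat" and b :: "nat \<Rightarrow> nat \<Rightarrow> 'k"
  assumes p: "1 \<le> p"
    and b: "\<And>k. k \<in> h ` D \<Longrightarrow> b k \<in> vcarrier (ell p) - {0}"
    and deviation: "\<And>x n. x \<in> vcarrier (ell p) \<Longrightarrow>
      partial_sum (ell p) standard_basis n x - partial_sum (ell p) a n x =
        (if n \<in> D then vscale (ell p) (x (h n)) (b (h n)) else 0)"
begin

text \<open>The p-th power of the size that coordinate \<open>k\<close> of \<open>x\<close> must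
  have for the deviation on the fibre over \<open>k\<close> to have norm 1.\<close>

definition weight :: "nat \<Rightarrow> real" where
  "weight k = vnorm (ell p) (b k) powr (- p)"

lemma vnorm_b_pos: "k \<in> h ` D \<Longrightarrow> 0 < vnorm (ell p) (b k)"
  using vnorm_ell_pos[OF p b] .

lemma deviation_in_ell:
  assumes "x \<in> vcarrier (ell p)"
  shows "partial_sum (ell p) standard_basis n x - partial_sum (ell p) a n x \<in> vcarrier (ell p)"
  using deviation[OF assms, of n] ell_scale_closed[of "b (h n)" p "x (h n)"] b[of "h n"]
  by (auto intro: finitely_supported_in_ell)

lemma vnorm_deviation:
  assumes "x \<in> vcarrier (ell p)"
  shows "vnorm (ell p) (partial_sum (ell p) standard_basis n x - partial_sum (ell p) a n x) =
    (if n \<in> D then norm (x (h n)) * vnorm (ell p) (b (h n)) else 0)"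
  using deviation[OF assms, of n] vnorm_ell_scale[OF p, of "b (h n)" "x (h n)"] b[of "h n"]
  by (simp add: vnorm_ell_zero)

lemma error_le:
  assumes x: "x \<in> vcarrier (ell p)"
  shows "vnorm (ell p) (x - partial_sum (ell p) a n x)
    \<le> vnorm (ell p) (x - partial_sum (ell p) standard_basis n x)
      + vnorm (ell p) (partial_sum (ell p) standard_basis n x - partial_sum (ell p) a n x)"
  using ell_add(2)[OF p ell_diff_closed[OF p x partial_sum_standard_basis_in_ell]
      deviation_in_ell[OF x], of n x n]
  by simp

text \<open>Together with \<open>error_le\<close> this makes error and deviation interchangeable up
  to the tail of \<open>x\<close>, which tends to 0.\<close>

lemma deviation_le:
  assumes x: "x \<in> vcarrier (ell p)"
  shows "vnorm (ell p) (partial_sum (ell p) standard_basis n x - partial_sum (ell p) a n x)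
    \<le> vnorm (ell p) (x - partial_sum (ell p) standard_basis n x)
      + vnorm (ell p) (x - partial_sum (ell p) a n x)"
proof -
  let ?E = "partial_sum (ell p) standard_basis n x" and ?A = "partial_sum (ell p) a n x"
  have xE: "x - ?E \<in> vcarrier (ell p)"
    by (rule ell_diff_closed[OF p x partial_sum_standard_basis_in_ell])
  have "x - ?A \<in> vcarrier (ell p)"
    using ell_add(1)[OF p xE deviation_in_ell[OF x, of n]] by simp
  moreover have "?E - x \<in> vcarrier (ell p)"
    by (rule ell_diff_closed[OF p partial_sum_standard_basis_in_ell x])
  ultimately show ?thesis
    using ell_add(2)[OF p, of "?E - x" "x - ?A"] by (simp add: ell_minus_commute)
qed

text \<open>The image under \<open>h\<close> counts each fibre once, since a single coordinate of
  \<open>x\<close> governs the deviation on all of it.\<close>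

definition crit :: "nat set set" where
  "crit = {A. finite (A - D) \<and> weight summable_on h ` (A \<inter> D)}"

lemma ideal_crit: "ideal_on_nat crit"
  unfolding ideal_on_nat_def crit_def
proof (intro conjI allI impI; clarsimp)
  fix A B :: "nat set"
  assume "weight summable_on h ` (A \<inter> D)" "finite (A - D)" "B \<subseteq> A"
  then show "finite (B - D) \<and> weight summable_on h ` (B \<inter> D)"
    by (meson Diff_mono finite_subset image_mono Int_mono order_refl summable_on_subset_banach)
next
  fix A B :: "nat set"
  assume "finite (A - D)" "weight summable_on h ` (A \<inter> D)"
    "finite (B - D)" "weight summable_on h ` (B \<inter> D)"
  then show "finite (A \<union> B - D) \<and> weight summable_on h ` ((A \<union> B) \<inter> D)"
    by (simp add: Un_Diff Int_Un_distrib2 image_Un summable_on_Un_iff)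
qed

text \<open>Beyond some \<open>N\<close> an error of at least \<open>e\<close> forces a deviation of
  at least \<open>e / 2\<close>. On the fibres where this happens, \<open>weight k\<close> is at
  most a constant times \<open>norm (x k) powr p\<close>, which is summable.\<close>

lemma schauder_crit: "ideal_schauder_basis (ell p) crit a"
  unfolding ideal_schauder_basis_def
proof (intro ballI allI impI)
  fix x :: "nat \<Rightarrow> 'k" and e :: real
  assume x: "x \<in> vcarrier (ell p)" and e: "0 < e"
  obtain N where N: "\<And>n. N \<le> n \<Longrightarrow>
      vnorm (ell p) (x - partial_sum (ell p) standard_basis n x) < e / 2"
    using eventually_tail_less[OF p x, of "e / 2"] e by auto
  define B where "B = {n\<in>D. e / 2 \<le> norm (x (h n)) * vnorm (ell p) (b (h n))}"
  have "{n. e \<le> vnorm (ell p) (x - partial_sum (ell p) a n x)} \<subseteq> {..<N} \<union> B"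
  proof
    fix n assume n: "n \<in> {n. e \<le> vnorm (ell p) (x - partial_sum (ell p) a n x)}"
    show "n \<in> {..<N} \<union> B"
    proof (cases "n < N")
      case False
      have "e / 2 \<le> (if n \<in> D then norm (x (h n)) * vnorm (ell p) (b (h n)) else 0)"
        using n N[of n] False error_le[OF x, of n] unfolding vnorm_deviation[OF x] by simp
      then show ?thesis using e by (auto simp: B_def split: if_splits)
    qed simp
  qed
  moreover have "B \<in> crit"
  proof -
    have "(\<lambda>k. (2 / e) powr p * norm (x k) powr p) summable_on UNIV"
      using x by (intro norm_summable_imp_summable_on) (auto simp: ell_def intro: summable_mult)
    then have s: "(\<lambda>k. (2 / e) powr p * norm (x k) powr p) summable_on h ` B"
      by (rule summable_on_subset_banach) simp
    have "weight summable_on h ` B"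
    proof (rule summable_on_comparison_test[OF s])
      fix k assume k: "k \<in> h ` B"
      then have pos: "0 < vnorm (ell p) (b k)" using vnorm_b_pos by (auto simp: B_def)
      have "1 / vnorm (ell p) (b k) \<le> 2 / e * norm (x k)"
        using k pos e by (auto simp: B_def field_simps)
      then have "(1 / vnorm (ell p) (b k)) powr p \<le> (2 / e * norm (x k)) powr p"
        using p pos by (intro powr_mono2) auto
      then show "weight k \<le> (2 / e) powr p * norm (x k) powr p"
        using pos e by (simp add: weight_def powr_mult powr_minus powr_divide field_simps)
    qed (simp add: weight_def)
    moreover have "B \<inter> D = B" "B - D = {}" by (auto simp: B_def)
    ultimately show ?thesis unfolding crit_def by (metis (lifting) finite.emptyI mem_Collect_eq)
  qed
  ultimately show "{n. e \<le> vnorm (ell p) (x - partial_sum (ell p) a n x)} \<in> crit"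
    using ideal_crit unfolding ideal_on_nat_def by (meson finite_lessThan)
qed

lemma crit_subset:
  assumes I: "ideal_on_nat I" and basis: "ideal_schauder_basis (ell p) I a"
  shows "crit \<subseteq> I"
proof
  fix A assume A: "A \<in> crit"
  define x :: "nat \<Rightarrow> 'k" where
    "x k = (if k \<in> h ` (A \<inter> D) then of_real (1 / vnorm (ell p) (b k)) else 0)" for k
  have "weight summable_on h ` (A \<inter> D)" using A by (simp add: crit_def)
  then have "(\<lambda>k. norm (x k) powr p) summable_on UNIV"
  proof (rule iffD2[OF summable_on_cong_neutral, rotated -1])
    fix k assume "k \<in> UNIV \<inter> h ` (A \<inter> D)"
    then show "norm (x k) powr p = weight k"
      using vnorm_b_pos[of k]
      by (auto simp: x_def weight_def norm_divide powr_divide powr_minus field_simps)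
  qed (auto simp: x_def)
  then have x: "x \<in> vcarrier (ell p)" by (simp add: ell_def summable_on_imp_summable)
  obtain N where N: "\<And>n. N \<le> n \<Longrightarrow>
      vnorm (ell p) (x - partial_sum (ell p) standard_basis n x) < 1 / 2"
    using eventually_tail_less[OF p x, of "1 / 2"] by auto
  define B where "B = {n. 1 / 2 \<le> vnorm (ell p) (x - partial_sum (ell p) a n x)}"
  have "A \<subseteq> ({..<N} \<union> (A - D)) \<union> B"
  proof
    fix n assume n: "n \<in> A"
    show "n \<in> ({..<N} \<union> (A - D)) \<union> B"
    proof (cases "n < N \<or> n \<notin> D")
      case False
      then have "norm (x (h n)) * vnorm (ell p) (b (h n)) = 1"
        using n vnorm_b_pos[of "h n"] by (auto simp: x_def norm_divide)
      then have "1 / 2 \<le> vnorm (ell p) (x - partial_sum (ell p) a n x)"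
        using False N[of n] deviation_le[OF x, of n] unfolding vnorm_deviation[OF x] by simp
      then show ?thesis by (simp add: B_def)
    qed (use n in auto)
  qed
  moreover have "finite ({..<N} \<union> (A - D))" using A by (simp add: crit_def)
  moreover have "B \<in> I"
    using basis x unfolding ideal_schauder_basis_def B_def by (metis half_gt_zero zero_less_one)
  ultimately show "A \<in> I" using I unfolding ideal_on_nat_def by meson
qed

lemma critical_ideal_eq: "critical_ideal (ell p) a = crit"
proof (rule critical_ideal_eqI[OF ideal_crit])
  fix I :: "nat set set" assume "ideal_on_nat I"
  then show "ideal_schauder_basis (ell p) I a \<longleftrightarrow> crit \<subseteq> I"
    using crit_subset schauder_crit by (auto simp: ideal_schauder_basis_def subset_iff)
qed

end

section \<open>Blocks\<close>

locale blocks =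
  fixes t :: "nat \<Rightarrow> nat"
  assumes mono_t: "strict_mono t" and t_0: "t 0 = 0"
begin

definition block :: "nat \<Rightarrow> nat" where
  "block n = (LEAST k. n < t (Suc k))"

lemma less_next: "n < t (Suc (block n))"
  unfolding block_def
  \<comment> \<open>The witness is \<open>n\<close> itself, because
    \<open>Suc n \<le> t (Suc n)\<close>.\<close>
  by (rule LeastI[of _ n]) (metis mono_t less_le_trans lessI strict_mono_imp_increasing)

lemma t_block_le: "t (block n) \<le> n"
proof (cases "block n")
  case (Suc k)
  then have "\<not> n < t (Suc k)"
    using not_less_Least[of k "\<lambda>k. n < t (Suc k)"] by (simp add: block_def)
  then show ?thesis using Suc by simp
qed (simp add: t_0)

lemma t_less_iff [simp]: "t i < t j \<longleftrightarrow> i < j"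
  using mono_t by (rule strict_mono_less)

lemma t_le_iff [simp]: "t i \<le> t j \<longleftrightarrow> i \<le> j"
  using mono_t by (rule strict_mono_less_eq)

lemma t_eq_iff [simp]: "t i = t j \<longleftrightarrow> i = j"
  using mono_t by (rule strict_mono_eq)

lemma block_eq_iff: "block n = k \<longleftrightarrow> t k \<le> n \<and> n < t (Suc k)"
proof
  assume "t k \<le> n \<and> n < t (Suc k)"
  then have "t k < t (Suc (block n))" "t (block n) < t (Suc k)"
    using less_next[of n] t_block_le[of n] by (blast intro: le_less_trans)+
  then show "block n = k" by simp
qed (use less_next t_block_le in auto)

lemma block_t [simp]: "block (t k) = k"
  by (simp add: block_eq_iff)

lemma block_mono: "m \<le> n \<Longrightarrow> block m \<le> block n"
proof -
  assume "m \<le> n"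
  then have "t (block m) < t (Suc (block n))"
    using t_block_le[of m] less_next[of n] by linarith
  then show ?thesis by simp
qed

text \<open>The blocks met by \<open>A\<close> are the values of \<open>block\<close> on
  \<open>A\<close>. This brings the ideal into the form of \<open>crit\<close>, summability over an
  image.\<close>

lemma block_summable_ideal_eq: "block_summable_ideal t r = {A. r summable_on block ` A}"
proof -
  have "{k. A \<inter> {t k..<t (Suc k)} \<noteq> {}} = block ` A" for A
  proof -
    have "block ` A = {k. \<exists>n\<in>A. block n = k}" by blast
    then show ?thesis unfolding block_eq_iff by auto
  qed
  then show ?thesis by (simp add: block_summable_ideal_def summable_ideal_def)
qed

end

section \<open>Critical ideals of simple systems are block summable\<close>

context simple_system
begin

text \<open>Neighbours in one fibre of \<open>h\<close>, which must share a block. A new block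
  starts after every index that is not linked.\<close>

definition linked :: "nat \<Rightarrow> bool" where
  "linked n \<longleftrightarrow> n \<in> D \<and> Suc n \<in> D \<and> h (Suc n) = h n"

definition starts :: "nat set" where
  "starts = insert 0 (Suc ` {n. \<not> linked n})"

lemma infinite_starts:
  assumes "UNIV \<notin> crit"
  shows "infinite starts"
proof
  assume "finite starts"
  then have "finite {n. \<not> linked n}" by (simp add: starts_def finite_image_iff)
  then obtain M where M: "\<And>n. M \<le> n \<Longrightarrow> linked n"
    by (metis (mono_tags, lifting) finite_nat_set_iff_bounded mem_Collect_eq not_less)
  have h: "h n = h M" if "M \<le> n" for n
    using that M by (induction n rule: dec_induct) (auto simp: linked_def)
  have "UNIV - D \<subseteq> {..<M}" using M by (auto simp: linked_def not_le[symmetric])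
  moreover have "h ` D \<subseteq> h ` {..M}"
    using h by (metis atMost_iff image_eqI image_subsetI nat_le_linear order_refl)
  ultimately have "finite (UNIV - D)" "finite (h ` D)"
    using finite_subset by (blast, meson finite_atMost finite_imageI finite_subset)
  then show False using assms by (simp add: crit_def)
qed

lemma crit_block_summable:
  assumes inj: "interval_to_one_on D h" and nontriv: "crit \<noteq> UNIV"
  shows "\<exists>t r. strict_mono t \<and> t 0 = 0 \<and> (\<forall>n. 0 < r n) \<and> \<not> summable r \<and>
            crit = block_summable_ideal t r"
proof -
  have UNIV: "UNIV \<notin> crit"
  proof
    assume "UNIV \<in> crit"
    then have "A \<in> crit" for A
      using ideal_crit unfolding ideal_on_nat_def by (meson subset_UNIV)
    then show False using nontriv by auto
  qed
  note inf = infinite_starts[OF UNIV]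
  define t where "t = enumerate starts"
  \<comment> \<open>A block inside \<open>D\<close> inherits the weight of its fibre. With weight 1
    off \<open>D\<close>, summability there means finiteness.\<close>
  define r where "r k = (if t k \<in> D then weight (h (t k)) else 1)" for k
  interpret blocks t
  proof
    show "strict_mono t" unfolding t_def using inf by (rule strict_mono_enumerate)
    show "t 0 = 0" by (simp add: t_def enumerate_0 starts_def)
  qed
  have t_start: "t k \<in> starts" for k
    unfolding t_def by (rule enumerate_in_set[OF inf])
  \<comment> \<open>No start lies strictly between consecutive values of \<open>t\<close>.\<close>
  have linked_inside: "linked n" if "t k \<le> n" "Suc n < t (Suc k)" for n k
  proof (rule ccontr)
    assume "\<not> linked n"
    then have "Suc n \<in> starts" by (simp add: starts_def)
    moreover have "t k < Suc n" using that by simp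
    ultimately have "t (Suc k) \<le> Suc n"
      unfolding t_def enumerate_Suc''[OF inf] by (intro Least_le) simp
    then show False using that by simp
  qed
  have same_class: "n = t k \<or> n \<in> D \<and> t k \<in> D \<and> h n = h (t k)"
    if "t k \<le> n" "n < t (Suc k)" for n k
    using that
  proof (induction n rule: dec_induct)
    case (step n)
    then have "linked n" "n = t k \<or> n \<in> D \<and> t k \<in> D \<and> h n = h (t k)"
      using linked_inside by simp_all
    then show ?case unfolding linked_def by metis
  qed simp
  have class_block: "n = t (block n) \<or> n \<in> D \<and> t (block n) \<in> D \<and> h n = h (t (block n))" for n
    using same_class[OF t_block_le less_next] .
  have D_iff: "t (block n) \<in> D \<longleftrightarrow> n \<in> D" for n
    using class_block[of n] by metis
  have h_block: "n \<in> D \<Longrightarrow> h (t (block n)) = h n" for n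
    using class_block[of n] by metis
  have t_block: "n \<notin> D \<Longrightarrow> t (block n) = n" for n
    using class_block[of n] by metis
  \<comment> \<open>Each fibre is a single block: if two starts shared a fibre, the interval
    condition would put the predecessor of the later one into it as well, so that predecessor would
    be linked.\<close>
  have inj_ht: "inj_on (h \<circ> t) {k. t k \<in> D}"
  proof (rule linorder_inj_onI)
    fix i j assume ij: "i < j" "i \<in> {k. t k \<in> D}" "j \<in> {k. t k \<in> D}"
    show "(h \<circ> t) i \<noteq> (h \<circ> t) j"
    proof
      assume "(h \<circ> t) i = (h \<circ> t) j"
      then have sub: "{t i..t j} \<subseteq> D \<inter> h -` {h (t i)}"
        using inj ij unfolding interval_to_one_on_def by auto
      obtain n where n: "t j = Suc n" using ij(1) t_less_iff[of i j] by (cases "t j") auto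
      then have "t i \<le> n" using ij(1) t_less_iff[of i j] by simp
      then have "n \<in> {t i..t j}" "Suc n \<in> {t i..t j}" using n by auto
      then have "n \<in> D \<inter> h -` {h (t i)}" "Suc n \<in> D \<inter> h -` {h (t i)}"
        using sub by blast+
      then have "linked n" by (simp add: linked_def)
      then show False using t_start[of j] n by (auto simp: starts_def)
    qed
  qed auto
  \<comment> \<open>Split \<open>A\<close> along \<open>D\<close>: on \<open>D\<close>,
    \<open>h \<circ> t\<close> reindexes blocks by fibres; off \<open>D\<close>, \<open>t\<close>
    maps each block number back to the only point of its block.\<close>
  have "r summable_on block ` A \<longleftrightarrow> A \<in> crit" for A
  proof -
    have "r summable_on block ` (A \<inter> D) \<longleftrightarrow> (weight \<circ> (h \<circ> t)) summable_on block ` (A \<inter> D)"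
      by (rule summable_on_cong) (auto simp: r_def D_iff)
    also have "\<dots> \<longleftrightarrow> weight summable_on (h \<circ> t) ` block ` (A \<inter> D)"
      by (rule summable_on_reindex[symmetric]) (rule inj_on_subset[OF inj_ht], auto simp: D_iff)
    also have "(h \<circ> t) ` block ` (A \<inter> D) = h ` (A \<inter> D)"
      unfolding image_image by (rule image_cong) (auto simp: h_block)
    finally have 1: "r summable_on block ` (A \<inter> D) \<longleftrightarrow> weight summable_on h ` (A \<inter> D)" .
    have "r summable_on block ` (A - D) \<longleftrightarrow> (\<lambda>_. 1 :: real) summable_on block ` (A - D)"
      by (rule summable_on_cong) (auto simp: r_def D_iff)
    also have "\<dots> \<longleftrightarrow> finite (t ` block ` (A - D))"
      by (simp add: summable_on_const_one_iff finite_image_iff inj_on_def)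
    also have "t ` block ` (A - D) = id ` (A - D)"
      unfolding image_image by (rule image_cong) (auto simp: t_block)
    finally have 2: "r summable_on block ` (A - D) \<longleftrightarrow> finite (A - D)" by simp
    have "block ` A = block ` (A \<inter> D) \<union> block ` (A - D)" by auto
    then show ?thesis using 1 2 by (auto simp: summable_on_Un_iff crit_def)
  qed
  then have eq: "crit = block_summable_ideal t r"
    by (auto simp: block_summable_ideal_eq)
  have pos: "0 < r k" for k
    using vnorm_b_pos[of "h (t k)"] by (auto simp: r_def weight_def)
  have "block ` UNIV = UNIV" by (metis block_t surjI)
  then have "\<not> summable r"
    using UNIV pos unfolding eq block_summable_ideal_eq
    by (simp add: summable_on_UNIV_nonneg_real_iff less_imp_le)
  then show ?thesis using eq pos mono_t t_0 by blast
qed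

end

section \<open>Block summable ideals are critical\<close>

lemma coord_in_vdual:
  assumes p: "1 \<le> p"
  shows "(\<lambda>x. x n) \<in> vdual (ell p :: ('k::real_normed_field, _) nspace)"
  using standard_basis_in_ell[OF p, where 'k = 'k]
  by (auto simp: standard_basis_def image_subset_iff)

lemma coord_diff_in_vdual:
  assumes p: "1 \<le> p"
  shows "(\<lambda>x. x n / c - x m / d) \<in> vdual (ell p :: ('k::real_normed_field, _) nspace)"
proof -
  let ?T = "Metric_space.mtopology (vcarrier (ell p)) (vdist (ell p :: ('k, _) nspace))"
  have coord: "continuous_map ?T euclidean (\<lambda>x. x n)" for n
    using coord_in_vdual[OF p, of n, where 'k = 'k] by (simp add: vdual_def)
  \<comment> \<open>Multiplying by \<open>inverse c\<close> instead of dividing avoids a case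
    distinction at \<open>c = 0\<close>.\<close>
  have "continuous_map ?T euclidean ((\<lambda>y. y * inverse c) \<circ> (\<lambda>x. x n))" for n and c :: 'k
    by (rule continuous_map_compose[OF coord]) (simp add: continuous_intros)
  then have "continuous_map ?T euclidean (\<lambda>x. x n / c - x m / d)"
    by (intro continuous_map_diff) (simp_all add: o_def divide_inverse)
  then show ?thesis
    by (simp add: vdual_def ell_def add_divide_distrib right_diff_distrib)
qed

locale block_system = blocks +
  fixes p :: real and r :: "nat \<Rightarrow> real"
  assumes p: "1 \<le> p" and r_pos: "\<And>k. 0 < r k"
begin

text \<open>To give block \<open>k\<close> the weight \<open>r k\<close>, the next p-th power must
  be \<open>r k\<close> times the sum so far, so that sum gets multiplied by
  \<open>1 + r k\<close>.\<close>

definition growth :: "nat \<Rightarrow> real" where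
  "growth k = (\<Prod>j<k. 1 + r j)"

text \<open>Chosen so that the \<open>p\<close>-th powers of the first \<open>k + 1\<close> terms sum to \<open>growth k\<close>.\<close>

definition step :: "nat \<Rightarrow> real" where
  "step k = (case k of 0 \<Rightarrow> 1 | Suc j \<Rightarrow> (growth j * r j) powr (1 / p))"

text \<open>Extension by 0 off the block starts makes the vectors of the summing basis truncations
  of one sequence.\<close>

definition coef :: "nat \<Rightarrow> real" where
  "coef m = (if m \<in> range t then step (block m) else 0)"

definition next_start :: "nat \<Rightarrow> nat" where
  "next_start n = t (Suc (block n))"

definition system :: "nat \<Rightarrow> (nat \<Rightarrow> 'k::real_normed_field) \<times> ((nat \<Rightarrow> 'k) \<Rightarrow> 'k)" where
  "system n = (if n \<in> range t
     then (\<lambda>m. if m \<le> n then of_real (coef m) else 0,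
           \<lambda>x. x n / of_real (coef n) - x (next_start n) / of_real (coef (next_start n)))
     else standard_basis n)"

definition jump :: "nat \<Rightarrow> nat \<Rightarrow> 'k::real_normed_field" where
  "jump k m = (if m < k then of_real (coef m / coef k) else 0)"

lemma growth_pos: "0 < growth k"
  unfolding growth_def using r_pos by (intro prod_pos) (simp add: add_pos_pos)

lemma step_pos: "0 < step k"
proof (cases k)
  case (Suc j)
  then show ?thesis using growth_pos[of j] r_pos[of j] by (simp add: step_def)
qed (simp add: step_def)

lemma coef_pos: "n \<in> range t \<Longrightarrow> 0 < coef n"
  by (simp add: coef_def step_pos)

lemma coef_nonneg: "0 \<le> coef n"
  using step_pos by (simp add: coef_def less_imp_le)

lemma coef_t: "coef (t k) = step k"
  by (simp add: coef_def)

lemma next_start_in_range: "next_start n \<in> range t"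
  by (simp add: next_start_def)

lemma less_next_start: "n < next_start n"
  by (simp add: next_start_def less_next)

lemma next_start_le:
  assumes "n < m" "m \<in> range t"
  shows "next_start n \<le> m"
proof -
  obtain j where j: "m = t j" using assms(2) by blast
  then have "t (block n) < t j" using t_block_le[of n] assms(1) by linarith
  then show ?thesis by (simp add: next_start_def j)
qed

lemma next_start_Suc: "Suc n \<in> range t \<Longrightarrow> next_start n = Suc n"
  using next_start_le[of n "Suc n"] less_next_start[of n] by simp

lemma next_start_Suc': "Suc n \<notin> range t \<Longrightarrow> next_start (Suc n) = next_start n"
proof -
  assume "Suc n \<notin> range t"
  then have "Suc n \<noteq> t (Suc (block n))" by blast
  then have "block (Suc n) = block n"
    using less_next[of n] t_block_le[of n] by (simp add: block_eq_iff[of "Suc n"])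
  then show ?thesis by (simp add: next_start_def)
qed

lemma coef_between: "n < m \<Longrightarrow> m < next_start n \<Longrightarrow> coef m = 0"
  using next_start_le[of n m] by (auto simp: coef_def)

text \<open>The cut-off may move from \<open>next_start n\<close> back to \<open>n\<close>, as
  \<open>coef\<close> vanishes in between.\<close>

lemma jump_next_start:
  "jump (next_start n) m = (if m \<le> n then of_real (coef m / coef (next_start n)) else 0)"
  using less_next_start[of n] coef_between[of n m] by (auto simp: jump_def)

lemma sum_step_powr: "(\<Sum>j\<le>k. step j powr p) = growth k"
proof (induction k)
  case (Suc k)
  have "step (Suc k) powr p = growth k * r k"
    using p growth_pos[of k] r_pos[of k] by (simp add: step_def powr_powr)
  then show ?case using Suc by (simp add: growth_def algebra_simps)
qed (simp add: step_def growth_def)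

lemma sum_coef_powr: "(\<Sum>m<t (Suc k). coef m powr p) = growth k"
proof -
  have "(\<Sum>m<t (Suc k). coef m powr p) = (\<Sum>m\<in>t ` {..k}. coef m powr p)"
    by (intro sum.mono_neutral_right) (auto simp: coef_def less_Suc_eq_le simp flip: less_Suc_eq_le)
  also have "\<dots> = (\<Sum>j\<le>k. step j powr p)"
    by (subst sum.reindex) (simp_all add: inj_on_def coef_t)
  finally show ?thesis by (simp add: sum_step_powr)
qed

lemma jump_in_ell: "jump k \<in> vcarrier (ell p)"
  by (rule finitely_supported_in_ell) (auto simp: jump_def intro: finite_subset[of _ "{..<k}"])

text \<open>The p-th power of the norm is \<open>growth k / (growth k * r k)\<close>;
  \<open>step\<close> was chosen for this quotient.\<close>

lemma vnorm_jump:
  "vnorm (ell p) (jump (t (Suc k)) :: nat \<Rightarrow> 'k::real_normed_field) powr (- p) = r k"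
proof -
  have "(\<Sum>m. norm (jump (t (Suc k)) m :: 'k) powr p)
      = (\<Sum>m<t (Suc k). norm (jump (t (Suc k)) m :: 'k) powr p)"
    by (rule suminf_finite) (auto simp: jump_def)
  also have "\<dots> = (\<Sum>m<t (Suc k). coef m powr p) / step (Suc k) powr p"
    unfolding sum_divide_distrib
    using step_pos[of "Suc k"]
    by (intro sum.cong)
      (simp_all add: jump_def coef_t coef_nonneg norm_divide powr_divide)
  also have "\<dots> = 1 / r k"
    unfolding sum_coef_powr
    using p growth_pos[of k] r_pos[of k] by (simp add: step_def powr_powr)
  finally show ?thesis
    using p r_pos[of k] by (simp add: ell_def powr_powr powr_minus)
qed

text \<open>The sums telescope. At a block start the first term of the new functional cancels the
  correction carried so far and supplies the new coordinate; its second term is the next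
  correction.\<close>

lemma partial_sum_system:
  fixes x :: "nat \<Rightarrow> 'k::real_normed_field"
  shows "partial_sum (ell p) system n x m
    = (if m \<le> n then x m else 0) - x (next_start n) * jump (next_start n) m"
proof (induction n)
  case 0
  have "0 \<in> range t" using t_0 by (metis rangeI)
  then show ?case
    using coef_pos[of 0]
    by (auto simp: partial_sum_0 system_def[of 0] jump_next_start field_simps)
next
  case (Suc n)
  show ?case
  proof (cases "Suc n \<in> range t")
    case True
    moreover from this have "jump (Suc n) m
        = (if m \<le> n then of_real (coef m / coef (Suc n)) else 0 :: 'k)"
      using jump_next_start[of n m, where 'a = 'k] next_start_Suc[of n] by simp
    ultimately show ?thesis
      using coef_pos[of "Suc n"]
      by (auto simp: partial_sum_Suc Suc.IH system_def[of "Suc n"] jump_next_start next_start_Suc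
          le_Suc_eq algebra_simps)
  next
    case False
    \<comment> \<open>Hence moving the cut-off from \<open>n\<close> to \<open>Suc n\<close> leaves
      the correction unchanged.\<close>
    then have "coef (Suc n) = 0" by (simp add: coef_def)
    then show ?thesis
      using False
      by (auto simp: partial_sum_Suc Suc.IH system_def[of "Suc n"] jump_next_start next_start_Suc'
          standard_basis_def le_Suc_eq)
  qed
qed

text \<open>For starts \<open>n < m\<close> also \<open>next_start n \<le> m\<close>, so both terms
  of the functional equal 1 on the vector at \<open>m\<close> and cancel; for \<open>m = n\<close>
  only the first survives. The vectors at starts vanish at all other coordinates.\<close>

lemma biorthogonal_system:
  "biorthogonal (system :: nat \<Rightarrow> (nat \<Rightarrow> 'k::real_normed_field) \<times> _)"
  unfolding biorthogonal_def
proof (intro allI)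
  fix n m
  show "snd (system n) (fst (system m :: (nat \<Rightarrow> 'k) \<times> _)) = (if n = m then 1 else 0)"
  proof (cases "n \<in> range t")
    case n: True
    show ?thesis
    proof (cases "m \<in> range t")
      case True
      then show ?thesis
        using n coef_pos[of n] coef_pos[OF next_start_in_range, of n] less_next_start[of n]
          next_start_le[of n m]
        by (cases n m rule: linorder_cases) (simp_all add: system_def)
    next
      case False
      then have "m \<noteq> n" "m \<noteq> next_start n" using n next_start_in_range[of n] by auto
      then show ?thesis using n False by (simp add: system_def standard_basis_def)
    qed
  next
    case n: False
    then have "coef n = 0" by (simp add: coef_def)
    then show ?thesis
      using n by (cases "m \<in> range t") (auto simp: system_def standard_basis_def)
  qed
qed

lemma range_system:
  "range system \<subseteq> vcarrier (ell p) \<times> vdual (ell p :: ('k::real_normed_field, _) nspace)"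
proof -
  have "system n \<in> vcarrier (ell p) \<times> vdual (ell p :: ('k, _) nspace)" for n
  proof (cases "n \<in> range t")
    case True
    have "(\<lambda>m. if m \<le> n then of_real (coef m) else 0) \<in> vcarrier (ell p :: ('k, _) nspace)"
      by (rule finitely_supported_in_ell) (auto intro: finite_subset[of _ "{..n}"])
    then show ?thesis using True coord_diff_in_vdual[OF p] by (simp add: system_def)
  next
    case False
    then show ?thesis
      using standard_basis_in_ell[OF p, where 'k = 'k] by (auto simp: system_def)
  qed
  then show ?thesis by blast
qed

lemma system_simple: "simple_system p system UNIV next_start
  (jump :: nat \<Rightarrow> nat \<Rightarrow> 'k::real_normed_field)"
proof
  fix k assume "k \<in> range next_start"
  then obtain n where k: "k = next_start n" by blast
  \<comment> \<open>Coordinate 0 is a start below every \<open>next_start n\<close>, so it witnesses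
    that \<open>jump k\<close> is nonzero.\<close>
  have "0 \<in> range t" using t_0 by (metis rangeI)
  then have "jump k 0 \<noteq> (0 :: 'k)"
    using coef_pos[of 0] coef_pos[OF next_start_in_range[of n]] by (simp add: k jump_next_start)
  then show "jump k \<in> vcarrier (ell p) - {0 :: nat \<Rightarrow> 'k}" using jump_in_ell by auto
next
  fix x :: "nat \<Rightarrow> 'k" and n
  show "partial_sum (ell p) standard_basis n x - partial_sum (ell p) system n x
    = (if n \<in> UNIV then vscale (ell p) (x (next_start n)) (jump (next_start n)) else 0)"
    by (rule ext) (simp add: partial_sum_system partial_sum_standard_basis, simp add: ell_def)
qed (rule p)

lemma interval_to_one_next_start: "interval_to_one_on UNIV next_start"
  unfolding interval_to_one_on_def
proof clarsimp
  fix i j l assume "next_start j = next_start i" "i \<le> l" "l \<le> j"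
  then show "next_start l = next_start i"
    using block_mono[of i l] block_mono[of l j] by (simp add: next_start_def)
qed

text \<open>The fibre of \<open>next_start\<close> over \<open>t (Suc k)\<close> is block
  \<open>k\<close>, so reindexing along \<open>t \<circ> Suc\<close> turns the weights into
  \<open>r\<close>.\<close>

lemma critical_ideal_system:
  "critical_ideal (ell p) (system :: nat \<Rightarrow> (nat \<Rightarrow> 'k::real_normed_field) \<times> _)
    = block_summable_ideal t r"
proof -
  interpret S: simple_system p system UNIV next_start "jump :: nat \<Rightarrow> nat \<Rightarrow> 'k"
    by (rule system_simple)
  have "S.weight summable_on next_start ` A \<longleftrightarrow> r summable_on block ` A" for A
  proof -
    have "next_start ` A = (t \<circ> Suc) ` block ` A"
      by (simp add: image_image next_start_def)
    moreover have "S.weight \<circ> (t \<circ> Suc) = r"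
      by (simp add: fun_eq_iff S.weight_def vnorm_jump)
    moreover have "inj_on (t \<circ> Suc) (block ` A)" by (simp add: inj_on_def)
    ultimately show ?thesis using summable_on_reindex by metis
  qed
  then show ?thesis
    by (simp add: S.critical_ideal_eq S.crit_def block_summable_ideal_eq)
qed

end

theorem theorem5p9:
  fixes p :: real and I :: "nat set set"
  assumes "1 \<le> p" and "ideal_on_nat I" and "I \<noteq> UNIV"
  shows "(\<exists>a :: nat \<Rightarrow> (nat \<Rightarrow> 'k::{real_normed_field, banach}) \<times> ((nat \<Rightarrow> 'k) \<Rightarrow> 'k).
            range a \<subseteq> vcarrier (ell p) \<times> vdual (ell p) \<and> biorthogonal a \<and>
            simple_over (ell p) a standard_basis \<and>
            critical_ideal (ell p) a = I)
     \<longleftrightarrow> (\<exists>(t :: nat \<Rightarrow> nat) (r :: nat \<Rightarrow> real).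
            strict_mono t \<and> t 0 = 0 \<and> (\<forall>n. 0 < r n) \<and> \<not> summable r \<and>
            I = block_summable_ideal t r)"
    (is "?critical \<longleftrightarrow> ?block")
proof
  assume ?critical
  then obtain a :: "nat \<Rightarrow> (nat \<Rightarrow> 'k) \<times> ((nat \<Rightarrow> 'k) \<Rightarrow> 'k)"
    where "simple_over (ell p) a standard_basis" and I: "critical_ideal (ell p) a = I" by blast
  then obtain D h b where inj: "interval_to_one_on D h"
    and b: "\<forall>k\<in>h ` D. b k \<in> vcarrier (ell p) - {0}"
    and dev: "\<forall>x\<in>vcarrier (ell p). \<forall>n.
        partial_sum (ell p) standard_basis n x - partial_sum (ell p) a n x =
          (if n \<in> D then vscale (ell p) (snd (standard_basis (h n)) x) (b (h n)) else 0)"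
    unfolding simple_over_def by blast
  interpret simple_system p a D h b
    by standard (use assms(1) b dev in \<open>auto simp: standard_basis_def\<close>)
  show ?block
    using crit_block_summable[OF inj] assms(3) I critical_ideal_eq by simp
next
  assume ?block
  then obtain t r where tr: "strict_mono t" "t 0 = 0" "\<forall>n. 0 < r n"
    and I: "I = block_summable_ideal t r" by blast
  interpret block_system t p r
    by standard (use assms(1) tr in auto)
  interpret S: simple_system p system UNIV next_start "jump :: nat \<Rightarrow> nat \<Rightarrow> 'k"
    by (rule system_simple)
  have "simple_over (ell p) (system :: nat \<Rightarrow> (nat \<Rightarrow> 'k) \<times> _) standard_basis"
    unfolding simple_over_def
    using interval_to_one_next_start S.b S.deviation
    by (intro exI[of _ UNIV] exI[of _ next_start] exI[of _ "jump :: nat \<Rightarrow> nat \<Rightarrow> 'k"])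
      (auto simp: standard_basis_def)
  then show ?critical
    using range_system biorthogonal_system critical_ideal_system I
    by (intro exI[of _ system] conjI) simp_all
qed

end
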